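(* Let $1 \le k < n$ and $\varepsilon > 0$, and consider the continuous piecewise-linear system on $\mathbb{R}^n$ $$\dot{\tilde z} = \begin{cases} P_L(\varepsilon)\tilde z + c(\varepsilon)\tilde\mu, & \tilde z_1 \le 0,\\ P_R(\varepsilon)\tilde z + c(\varepsilon)\tilde\mu, & \tilde z_1 \ge 0,\end{cases}$$ with parameter $\tilde\mu \in \mathbb{R}$, having the slow-fast block form described in the context. Let $\Phi$, $Q$, $d$, $s$ and $E$ be defined as in the context. If $\Phi$ is non-singular and $s \ne 0$, then the change of variables $$z = E^{-1}\left(Q\tilde z + d\tilde\mu\right), \qquad \mu = \frac{s}{\varepsilon^{n-k}}\tilde\mu,$$ transforms the system into the slow-fast observer canonical form $$\dot z = \begin{cases} C_L(\varepsilon) z + \varepsilon e_n\mu, & z_1 \le 0,\\ C_R(\varepsilon) z + \varepsilon e_n\mu, & z_1 \ge 0,\end{cases}$$ where, for $X = L,R$, the matrix $C_X(\varepsilon)$ has the form given in the context for some $a^X(\varepsilon) \in \mathbb{R}^k$ and $b^X(\varepsilon) \in \mathbb{R}^{n-k}$.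
   Context: Here $e_1,\ldots,e_n$ is the standard basis of $\mathbb{R}^n$ and $J_n = [\,0\; e_1 \cdots e_{n-1}\,]$ is the $n\times n$ matrix with ones on the superdiagonal and zeros elsewhere. Slow-fast block form: $P_X(\varepsilon) = \begin{bmatrix} U_X(\varepsilon) \\ \varepsilon V_X(\varepsilon)\end{bmatrix}$ for $X = L,R$ and $c(\varepsilon) = \begin{bmatrix} q(\varepsilon)\\ \varepsilon r(\varepsilon)\end{bmatrix}$, where $U_X$ is a real $k\times n$ matrix, $V_X$ is a real $(n-k)\times n$ matrix, $q \in \mathbb{R}^k$, $r \in \mathbb{R}^{n-k}$. The system is assumed continuous on $\tilde z_1 = 0$, i.e. $P_L$ and $P_R$ differ only in their first columns. Let $p^L \in \mathbb{R}^n$ be the coefficient vector of the characteristic polynomial of $P_L$: $\det(\lambda I - P_L) = \lambda^n + p^L_1\lambda^{n-1} + \cdots + p^L_n$. Let $\Psi$ be the $n\times n$ lower triangular Toeplitz matrix with entries $\Psi_{ii} = 1$, $\Psi_{ij} = p^L_{i-j}$ for $i > j$, and $\Psi_{ij} = 0$ for $i<j$. Let $\Phi$ be the $n\times n$ matrix whose $i$-th row is $e_1^{\sf T} P_L^{i-1}$, $i = 1,\ldots,n$. Let $Q = \Psi\Phi$, $d = J_n^{\sf T} Q c$, $s = e_n^{\sf T} Q c$. $E = E(\varepsilon)$ is the $n\times n$ diagonal matrix with diagonal entries $1,\ldots,1$ ($k$ times) followed by $1,\varepsilon,\varepsilon^2,\ldots,\varepsilon^{n-k-1}$. $C_X(\varepsilon)$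 is the $n\times n$ matrix whose first column is $\left(-a^X_1,\ldots,-a^X_k,-\varepsilon b^X_1,\ldots,-\varepsilon b^X_{n-k}\right)^{\sf T}$, plus superdiagonal entries equal to $1$ in rows $1,\ldots,k$ (entry $(i,i+1)$ is $1$ for $i \le k$) and equal to $\varepsilon$ in rows $k+1,\ldots,n-1$ (entry $(i,i+1)$ is $\varepsilon$ for $k<i<n$); all other entries are zero. *)

theory Defs
  imports "HOL-Analysis.Analysis" "Jordan_Normal_Form.Jordan_Normal_Form"
    "Jordan_Normal_Form.Gauss_Jordan_Elimination"
begin

text \<open>
  Matrices and vectors are those of Jordan_Normal_Form, so all indices are shifted by one
  against the usual mathematical convention: \<open>z $ 0\<close> is \<open>z\<^sub>1\<close>, \<open>unit_vec n (n - 1)\<close> is \<open>e\<^sub>n\<close>.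
\<close>

section \<open>Continuous piecewise-linear systems\<close>

definition has_vec_deriv :: "nat \<Rightarrow> (real \<Rightarrow> real vec) \<Rightarrow> real vec \<Rightarrow> real \<Rightarrow> real set \<Rightarrow> bool" where
  "has_vec_deriv n z w t I \<longleftrightarrow>
     (\<forall>i<n. ((\<lambda>\<tau>. z \<tau> $ i) has_real_derivative w $ i) (at t within I))"

text \<open>
  \<open>z\<close> solves \<open>z' = A\<^sub>L z + g m\<close> for \<open>z\<^sub>1 \<le> 0\<close> and \<open>z' = A\<^sub>R z + g m\<close> for \<open>z\<^sub>1 \<ge> 0\<close> on the time set \<open>I\<close>.
  On \<open>z\<^sub>1 = 0\<close> both equations are required; they agree there when the system is continuous.
\<close>

definition pwl_solution ::
  "nat \<Rightarrow> real mat \<Rightarrow> real mat \<Rightarrow> real vec \<Rightarrow> real \<Rightarrow> real set \<Rightarrow> (real \<Rightarrow> real vec) \<Rightarrow> bool" where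
  "pwl_solution n A\<^sub>L A\<^sub>R g m I z \<longleftrightarrow>
     (\<forall>t\<in>I. z t \<in> carrier_vec n \<and>
        (z t $ 0 \<le> 0 \<longrightarrow> has_vec_deriv n z (A\<^sub>L *\<^sub>v z t + m \<cdot>\<^sub>v g) t I) \<and>
        (z t $ 0 \<ge> 0 \<longrightarrow> has_vec_deriv n z (A\<^sub>R *\<^sub>v z t + m \<cdot>\<^sub>v g) t I))"

text \<open>
  The change of variables \<open>z = T x m\<close>, \<open>\<mu> = S m\<close> transforms the system \<open>(A\<^sub>L, A\<^sub>R, g)\<close> with state \<open>x\<close>
  and parameter \<open>m\<close> into the system \<open>(B\<^sub>L, B\<^sub>R, h)\<close> with state \<open>z\<close> and parameter \<open>\<mu>\<close>: it is a
  bijection of the state-parameter space, it takes each of the two pieces of the phase space to the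
  corresponding piece, and it identifies the solutions of the two systems.
\<close>

definition transforms_pwl ::
  "nat \<Rightarrow> (real vec \<Rightarrow> real \<Rightarrow> real vec) \<Rightarrow> (real \<Rightarrow> real) \<Rightarrow>
   real mat \<Rightarrow> real mat \<Rightarrow> real vec \<Rightarrow> real mat \<Rightarrow> real mat \<Rightarrow> real vec \<Rightarrow> bool" where
  "transforms_pwl n T S A\<^sub>L A\<^sub>R g B\<^sub>L B\<^sub>R h \<longleftrightarrow>
     bij_betw (\<lambda>(x, m). (T x m, S m)) (carrier_vec n \<times> UNIV) (carrier_vec n \<times> UNIV) \<and>
     (\<forall>x\<in>carrier_vec n. \<forall>m.
        (T x m $ 0 \<le> 0 \<longleftrightarrow> x $ 0 \<le> 0) \<and> (T x m $ 0 \<ge> 0 \<longleftrightarrow> x $ 0 \<ge> 0)) \<and>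
     (\<forall>m I x. is_interval I \<and> (\<forall>t\<in>I. x t \<in> carrier_vec n) \<longrightarrow>
        (pwl_solution n A\<^sub>L A\<^sub>R g m I x \<longleftrightarrow>
         pwl_solution n B\<^sub>L B\<^sub>R h (S m) I (\<lambda>t. T (x t) m)))"

section \<open>The matrices and vectors of the change of variables\<close>

text \<open>\<open>charp n P i\<close> is the coefficient of \<open>\<lambda>\<^bsup>n-i\<^esup>\<close> in \<open>det (\<lambda> I - P)\<close>.\<close>

definition charp :: "nat \<Rightarrow> real mat \<Rightarrow> nat \<Rightarrow> real" where
  "charp n P i = coeff (char_poly P) (n - i)"

definition Psi_mat :: "nat \<Rightarrow> real mat \<Rightarrow> real mat" where
  "Psi_mat n P = mat n n (\<lambda>(i, j). if i = j then 1 else if j < i then charp n P (i - j) else 0)"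

definition Phi_mat :: "nat \<Rightarrow> real mat \<Rightarrow> real mat" where
  "Phi_mat n P = mat\<^sub>r n n (\<lambda>i. row (P ^\<^sub>m i) 0)"

definition Q_mat :: "nat \<Rightarrow> real mat \<Rightarrow> real mat" where
  "Q_mat n P = Psi_mat n P * Phi_mat n P"

text \<open>\<open>jordan_block n 0\<close> is the matrix \<open>J\<^sub>n\<close> with ones on the superdiagonal and zeros elsewhere.\<close>

definition d_vec :: "nat \<Rightarrow> real mat \<Rightarrow> real vec \<Rightarrow> real vec" where
  "d_vec n P c = transpose_mat (jordan_block n 0) *\<^sub>v (Q_mat n P *\<^sub>v c)"

definition s_val :: "nat \<Rightarrow> real mat \<Rightarrow> real vec \<Rightarrow> real" where
  "s_val n P c = unit_vec n (n - 1) \<bullet> (Q_mat n P *\<^sub>v c)"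

definition E_mat :: "nat \<Rightarrow> nat \<Rightarrow> real \<Rightarrow> real mat" where
  "E_mat k n \<epsilon> = mat_diag n (\<lambda>i. if i < k then 1 else \<epsilon> ^ (i - k))"

section \<open>The slow-fast observer canonical form\<close>

definition C_mat :: "nat \<Rightarrow> nat \<Rightarrow> real \<Rightarrow> real vec \<Rightarrow> real vec \<Rightarrow> real mat" where
  "C_mat k n \<epsilon> a b = mat n n (\<lambda>(i, j).
     if j = 0 then (if i < k then - (a $ i) else - (\<epsilon> * b $ (i - k)))
     else if j = Suc i then (if i < k then 1 else \<epsilon>)
     else 0)"

end

theory Submission
  imports Defs
begin

text \<open>
  Row \<open>i\<close> of \<open>Q\<close> is the Horner partial sum \<open>\<Sum>\<^sub>l p\<^sub>i\<^sub>-\<^sub>l e\<^sub>1\<^sup>T P\<^sub>L\<^sup>l\<close> (indices from \<open>0\<close>), so multiplying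
  it by \<open>P\<^sub>L\<close> gives row \<open>i + 1\<close> up to a multiple of \<open>e\<^sub>1\<^sup>T\<close>; for the last row the next partial sum is
  \<open>0\<close> by Cayley--Hamilton. Hence \<open>Q P\<^sub>L = (J + w e\<^sub>1\<^sup>T) Q\<close>, and the same holds for \<open>P\<^sub>R\<close>, which differs
  from \<open>P\<^sub>L\<close> by a multiple of \<open>e\<^sub>1\<^sup>T\<close>, the first row of \<open>Q\<close>. Conjugation with \<open>E\<close> turns the ones on the
  superdiagonal into the pattern of \<open>C\<^sub>X\<close>; the first column is then arbitrary, so \<open>a\<^sup>X\<close> and \<open>b\<^sup>X\<close>
  can be read off it. Since \<open>d\<close> is \<open>Q c\<close> shifted down by one, \<open>Q c - (J + w e\<^sub>1\<^sup>T) d = s e\<^sub>n\<close>.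
\<close>

section \<open>The Cayley-Hamilton theorem, entry by entry\<close>

text \<open>The coefficients of \<open>adj (X I - A) (X I - A) = \<chi>\<^sub>A I\<close>, for Cayley--Hamilton by telescoping.\<close>

lemma coeff_char_poly_Cayley_Hamilton_step:
  fixes A :: "'a::comm_ring_1 mat"
  assumes A: "A \<in> carrier_mat n n"
  defines "B \<equiv> \<lambda>m. mat n n (\<lambda>(i, j). coeff (adj_mat (char_poly_matrix A) $$ (i, j)) m)"
  shows "coeff (char_poly A) 0 \<cdot>\<^sub>m 1\<^sub>m n = - (B 0 * A)"
    and "coeff (char_poly A) (Suc m) \<cdot>\<^sub>m 1\<^sub>m n = B m - B (Suc m) * A"
proof -
  let ?C = "char_poly_matrix A" and ?D = "adj_mat (char_poly_matrix A)"
  have C: "?C \<in> carrier_mat n n" using A by simp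
  have D: "?D \<in> carrier_mat n n" using adj_mat(1)[OF C] .
  \<comment> \<open>\<open>pCons 0\<close> is multiplication by the indeterminate. Left unevaluated
    it covers both claims at once: its coefficient \<open>m\<close> is 0 for \<open>m = 0\<close>
    and an entry of \<open>B (m - 1)\<close> otherwise.\<close>
  have *: "coeff (char_poly A) m * (if i = j then 1 else 0) =
      coeff (pCons 0 (?D $$ (i, j))) m - (B m * A) $$ (i, j)" if "i < n" "j < n" for i j m
  proof -
    have "char_poly A * (if i = j then 1 else 0) = (?D * ?C) $$ (i, j)"
      using adj_mat(3)[OF C] that by (simp add: char_poly_def)
    also have "\<dots> = (\<Sum>l<n. ?D $$ (i, l) * ?C $$ (l, j))"
      using C D that by (simp add: scalar_prod_def atLeast0LessThan)
    also have "\<dots> = (\<Sum>l<n. (if l = j then pCons 0 (?D $$ (i, l)) else 0) - Polynomial.smult (A $$ (l, j)) (?D $$ (i, l)))"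
      using A that by (intro sum.cong) (auto simp: char_poly_matrix_def algebra_simps)
    also have "\<dots> = pCons 0 (?D $$ (i, j)) - (\<Sum>l<n. Polynomial.smult (A $$ (l, j)) (?D $$ (i, l)))"
      using that by (simp add: sum_subtractf)
    finally have "coeff (char_poly A * (if i = j then 1 else 0)) m =
        coeff (pCons 0 (?D $$ (i, j))) m - (\<Sum>l<n. A $$ (l, j) * coeff (?D $$ (i, l)) m)"
      by (simp add: coeff_sum)
    moreover have "(B m * A) $$ (i, j) = (\<Sum>l<n. A $$ (l, j) * coeff (?D $$ (i, l)) m)"
      using A that by (simp add: B_def scalar_prod_def atLeast0LessThan mult.commute)
    ultimately show ?thesis by (cases "i = j") auto
  qed
  show "coeff (char_poly A) 0 \<cdot>\<^sub>m 1\<^sub>m n = - (B 0 * A)"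
    by (rule eq_matI) (use A *[where m = 0] in \<open>auto simp: B_def\<close>)
  show "coeff (char_poly A) (Suc m) \<cdot>\<^sub>m 1\<^sub>m n = B m - B (Suc m) * A"
    by (rule eq_matI) (use A *[where m = "Suc m"] in \<open>auto simp: B_def\<close>)
qed

lemma pow_mat_Suc_left:
  fixes A :: "'a::semiring_1 mat"
  assumes "A \<in> carrier_mat n n"
  shows "A ^\<^sub>m Suc m = A * A ^\<^sub>m m"
proof (induction m)
  case (Suc m)
  then show ?case
    using assms by (metis assoc_mult_mat pow_carrier_mat pow_mat.simps(2))
qed (use assms in auto)

text \<open>Multiplying the \<open>m\<close>-th coefficient identity on the right by
  \<open>A ^\<^sub>m m\<close> and summing over \<open>m \<le> N\<close> telescopes to the single
  term \<open>- (B N * A ^\<^sub>m Suc N)\<close>, which vanishes once \<open>N\<close> exceeds the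
  degrees in the adjugate. Working with entries keeps the sums in the ring of scalars.\<close>

lemma Cayley_Hamilton_index:
  fixes A :: "'a::comm_ring_1 mat"
  assumes A: "A \<in> carrier_mat n n" and ij: "i < n" "j < n"
  shows "(\<Sum>m\<le>n. coeff (char_poly A) m * (A ^\<^sub>m m) $$ (i, j)) = 0"
proof -
  let ?D = "adj_mat (char_poly_matrix A)"
  define B where "B m = mat n n (\<lambda>(i, j). coeff (?D $$ (i, j)) m)" for m
  have B: "B m \<in> carrier_mat n n" for m by (simp add: B_def)
  note step = coeff_char_poly_Cayley_Hamilton_step[OF A, folded B_def]
  \<comment> \<open>The scalar coefficient is written as a scalar matrix, so that the matrix
    identities in \<open>step\<close> can be substituted for it.\<close>
  have summand: "coeff (char_poly A) m * (A ^\<^sub>m m) $$ (i, j) =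
      ((coeff (char_poly A) m \<cdot>\<^sub>m 1\<^sub>m n) * A ^\<^sub>m m) $$ (i, j)" for m
    using A ij pow_carrier_mat[OF A, of m] by (simp add: smult_mat_def[symmetric])
  have tele: "(\<Sum>m\<le>N. coeff (char_poly A) m * (A ^\<^sub>m m) $$ (i, j)) = - (B N * A ^\<^sub>m Suc N) $$ (i, j)" for N
  proof (induction N)
    case 0
    have BA: "B 0 * A \<in> carrier_mat n n" by (rule mult_carrier_mat[OF B A])
    have "coeff (char_poly A) 0 * (A ^\<^sub>m 0) $$ (i, j) = (- (B 0 * A) * A ^\<^sub>m 0) $$ (i, j)"
      by (simp only: summand step(1))
    also have "- (B 0 * A) * A ^\<^sub>m 0 = - (B 0 * A)"
      using right_mult_one_mat[OF uminus_carrier_mat[OF BA]] A by simp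
    also have "(- (B 0 * A)) $$ (i, j) = - (B 0 * A) $$ (i, j)"
      by (rule index_uminus_mat(1)) (use carrier_matD[OF BA] ij in auto)
    also have "B 0 * A = B 0 * A ^\<^sub>m Suc 0" using A by simp
    finally show ?case by (simp only: atMost_0 sum.insert sum.empty finite.emptyI empty_iff not_False_eq_True add_0_right)
  next
    case (Suc N)
    have P: "A ^\<^sub>m Suc N \<in> carrier_mat n n" by (rule pow_carrier_mat[OF A])
    have "coeff (char_poly A) (Suc N) * (A ^\<^sub>m Suc N) $$ (i, j) =
        ((B N - B (Suc N) * A) * A ^\<^sub>m Suc N) $$ (i, j)"
      by (simp only: summand step(2))
    also have "(B N - B (Suc N) * A) * A ^\<^sub>m Suc N = B N * A ^\<^sub>m Suc N - B (Suc N) * A * A ^\<^sub>m Suc N"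
      by (rule minus_mult_distrib_mat[OF B mult_carrier_mat[OF B A] P])
    also have "B (Suc N) * A * A ^\<^sub>m Suc N = B (Suc N) * A ^\<^sub>m Suc (Suc N)"
      using assoc_mult_mat[OF B A P] pow_mat_Suc_left[OF A, of "Suc N"] by metis
    also have "(B N * A ^\<^sub>m Suc N - B (Suc N) * A ^\<^sub>m Suc (Suc N)) $$ (i, j) =
        (B N * A ^\<^sub>m Suc N) $$ (i, j) - (B (Suc N) * A ^\<^sub>m Suc (Suc N)) $$ (i, j)"
      by (rule index_minus_mat(1))
        (use carrier_matD(1)[OF B] carrier_matD[OF A] ij in auto)
    finally show ?case using Suc.IH by (simp only: sum.atMost_Suc) simp
  qed
  \<comment> \<open>The summand \<open>n\<close> ensures that the sum up to \<open>N\<close>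
    contains all nonzero coefficients of the characteristic polynomial; the maximum puts
    \<open>N\<close> above all degrees in row \<open>i\<close> of the adjugate, so that this row of
    \<open>B N\<close> is zero.\<close>
  define N where "N = n + Suc (Max ((\<lambda>l. degree (?D $$ (i, l))) ` {..<n}))"
  have "degree (?D $$ (i, l)) < N" if "l < n" for l
  proof -
    have "degree (?D $$ (i, l)) \<le> Max ((\<lambda>l. degree (?D $$ (i, l))) ` {..<n})"
      by (rule Max_ge) (use that in auto)
    then show ?thesis unfolding N_def by linarith
  qed
  then have "row (B N) i = 0\<^sub>v n"
    using ij by (intro eq_vecI) (auto simp: B_def coeff_eq_0)
  then have "(B N * A ^\<^sub>m Suc N) $$ (i, j) = 0"
    using ij carrier_matD[OF B] carrier_matD[OF pow_carrier_mat[OF A, of "Suc N"]]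
    by (simp add: carrier_dim_vec del: pow_mat.simps)
  moreover have "(\<Sum>m\<le>N. coeff (char_poly A) m * (A ^\<^sub>m m) $$ (i, j)) =
      (\<Sum>m\<le>n. coeff (char_poly A) m * (A ^\<^sub>m m) $$ (i, j))"
    using degree_monic_char_poly[OF A]
    by (intro sum.mono_neutral_right) (auto simp: N_def coeff_eq_0)
  ultimately show ?thesis using tele[of N] by simp
qed

section \<open>Determinants and the invertibility of Q\<close>

lemma invertible_mat_iff_det:
  fixes A :: "'a::field mat"
  assumes A: "A \<in> carrier_mat n n"
  shows "invertible_mat A \<longleftrightarrow> det A \<noteq> 0"
proof
  assume "invertible_mat A"
  then obtain B where AB: "A * B = 1\<^sub>m n" and BA: "B * A = 1\<^sub>m (dim_row B)"
    using A by (auto simp: invertible_mat_def inverts_mat_def)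
  \<comment> \<open>\<open>invertible_mat\<close> does not fix the size of the inverse. The column
    count of \<open>B\<close> comes from \<open>A * B\<close>, its row count from comparing the
    columns of \<open>B * A\<close> with those of the identity.\<close>
  have B: "B \<in> carrier_mat n n"
    using arg_cong[OF AB, of dim_col] arg_cong[OF BA, of dim_col] A by auto
  have "det A * det B = 1" using det_mult[OF A B] AB by simp
  then show "det A \<noteq> 0" by auto
next
  assume "det A \<noteq> 0"
  then obtain B where "B \<in> carrier_mat n n" "B * A = 1\<^sub>m n" "A * B = 1\<^sub>m n"
    using det_non_zero_imp_unit[OF A, of "TYPE('a)"] by (auto simp: Units_def ring_mat_def)
  then show "invertible_mat A"
    using A by (auto simp: invertible_mat_def inverts_mat_def)
qed

lemma det_Psi_mat: "det (Psi_mat n P) = 1"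
proof -
  have "det (Psi_mat n P) = prod_list (diag_mat (Psi_mat n P))"
    by (rule det_lower_triangular[of n]) (auto simp: Psi_mat_def)
  also have "\<dots> = 1"
    unfolding prod_list_diag_prod by (rule prod.neutral) (auto simp: Psi_mat_def)
  finally show ?thesis .
qed

lemma Phi_mat_carrier [simp]: "Phi_mat n P \<in> carrier_mat n n"
  by (simp add: Phi_mat_def)

lemma Psi_mat_carrier [simp]: "Psi_mat n P \<in> carrier_mat n n"
  by (simp add: Psi_mat_def)

lemma Q_mat_carrier [simp]: "Q_mat n P \<in> carrier_mat n n"
  by (simp add: Q_mat_def mult_carrier_mat[OF Psi_mat_carrier Phi_mat_carrier])

text \<open>\<Psi> is unitriangular, so Q and \<Phi> have the same determinant.\<close>

lemma invertible_Q_mat: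
  assumes "invertible_mat (Phi_mat n P)"
  shows "invertible_mat (Q_mat n P)"
proof -
  have "det (Q_mat n P) = det (Phi_mat n P)"
    unfolding Q_mat_def by (subst det_mult[of _ n]) (simp_all add: det_Psi_mat)
  then show ?thesis
    using assms by (simp add: invertible_mat_iff_det[of _ n])
qed

section \<open>Entries of Q and the shift relation\<close>

lemma charp_0:
  assumes "P \<in> carrier_mat n n"
  shows "charp n P 0 = 1"
  using degree_monic_char_poly[OF assms] by (auto simp: charp_def)

text \<open>Lower triangularity of \<Psi> cuts the sum off at \<open>i\<close>, and
  \<open>charp n P 0 = 1\<close> lets the unit diagonal follow the same formula as the entries below
  it.\<close>

lemma Q_mat_index:
  assumes P: "P \<in> carrier_mat n n" and ij: "i < n" "j < n"
  shows "Q_mat n P $$ (i, j) = (\<Sum>l\<le>i. charp n P (i - l) * (P ^\<^sub>m l) $$ (0, j))"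
proof -
  have "Q_mat n P $$ (i, j) = (\<Sum>l<n. Psi_mat n P $$ (i, l) * (P ^\<^sub>m l) $$ (0, j))"
    using ij P by (auto simp: Q_mat_def Psi_mat_def Phi_mat_def scalar_prod_def atLeast0LessThan
        intro!: sum.cong)
  also have "\<dots> = (\<Sum>l\<le>i. charp n P (i - l) * (P ^\<^sub>m l) $$ (0, j))"
    using ij charp_0[OF P] by (intro sum.mono_neutral_cong_right) (auto simp: Psi_mat_def)
  finally show ?thesis .
qed

text \<open>This normalisation is used twice: it keeps the switching hyperplane in place, and it
  confines the term \<open>w e_1^T Q\<close> to column 0.\<close>

lemma Q_mat_index_0:
  assumes "P \<in> carrier_mat n n" and "j < n"
  shows "Q_mat n P $$ (0, j) = (if j = 0 then 1 else 0)"
  using assms Q_mat_index[of P n 0 j] by (auto simp: charp_0)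

lemma Q_mat_mult_index:
  assumes P: "P \<in> carrier_mat n n" and ij: "i < n" "0 < j" "j < n"
  shows "(Q_mat n P * P) $$ (i, j) = (if Suc i < n then Q_mat n P $$ (Suc i, j) else 0)"
proof -
  have "(Q_mat n P * P) $$ (i, j) = (\<Sum>r<n. (\<Sum>l\<le>i. charp n P (i - l) * (P ^\<^sub>m l) $$ (0, r)) * P $$ (r, j))"
    using P ij Q_mat_index[OF P] by (auto simp: scalar_prod_def atLeast0LessThan carrier_matD[OF Q_mat_carrier])
  also have "\<dots> = (\<Sum>l\<le>i. charp n P (i - l) * (\<Sum>r<n. (P ^\<^sub>m l) $$ (0, r) * P $$ (r, j)))"
    unfolding sum_distrib_right sum_distrib_left by (subst sum.swap) (simp add: mult.assoc)
  also have "\<dots> = (\<Sum>l\<le>i. charp n P (i - l) * (P ^\<^sub>m Suc l) $$ (0, j))"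
    using P ij by (auto simp: scalar_prod_def atLeast0LessThan intro!: sum.cong)
  \<comment> \<open>After reindexing, the term \<open>l = 0\<close> may be added for free: it is a
    multiple of entry \<open>(0, j)\<close> of the identity matrix, which is 0 because
    \<open>j > 0\<close>.\<close>
  also have "\<dots> = (\<Sum>l\<le>Suc i. charp n P (Suc i - l) * (P ^\<^sub>m l) $$ (0, j))"
    using P ij by (subst sum.atMost_Suc_shift) simp
  also have "\<dots> = (if Suc i < n then Q_mat n P $$ (Suc i, j) else 0)"
  proof (cases "Suc i < n")
    case True
    then show ?thesis using Q_mat_index[OF P] ij by simp
  next
    case False
    \<comment> \<open>Here \<open>charp n P (n - l)\<close> is the coefficient of degree
      \<open>l\<close>, so the sum is an entry of the characteristic polynomial evaluated at
      \<open>P\<close>.\<close>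
    then have "Suc i = n" using ij by simp
    then show ?thesis
      using Cayley_Hamilton_index[OF P, of 0 j] ij by (simp add: charp_def)
  qed
  finally show ?thesis .
qed

section \<open>Matrices in observer form\<close>

text \<open>\<open>obs_mat n w\<close> is \<open>J\<^sub>n + w e\<^sub>1\<^sup>T\<close>.\<close>

definition obs_mat :: "nat \<Rightarrow> 'a::zero_neq_one vec \<Rightarrow> 'a mat" where
  "obs_mat n w = mat n n (\<lambda>(i, j). if j = 0 then w $ i else if j = Suc i then 1 else 0)"

lemma obs_mat_carrier [simp]: "obs_mat n w \<in> carrier_mat n n"
  by (simp add: obs_mat_def)

lemma obs_mat_mult_vec_index:
  fixes x :: "'a::comm_ring_1 vec"
  assumes "x \<in> carrier_vec n" and "i < n"
  shows "(obs_mat n w *\<^sub>v x) $ i = w $ i * x $ 0 + (if Suc i < n then x $ Suc i else 0)"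
proof -
  have "(obs_mat n w *\<^sub>v x) $ i =
      (\<Sum>j<n. (if j = 0 then w $ i * x $ 0 else 0) + (if j = Suc i then x $ Suc i else 0))"
    using assms by (auto simp: obs_mat_def scalar_prod_def atLeast0LessThan intro!: sum.cong)
  also have "\<dots> = w $ i * x $ 0 + (if Suc i < n then x $ Suc i else 0)"
    using assms by (subst sum.distrib) (auto simp: sum.delta)
  finally show ?thesis .
qed

text \<open>Since row 0 of \<open>M\<close> is \<open>e_1^T\<close>, the vector \<open>w\<close>
  acts on column 0 only. The columns \<open>j > 0\<close> are matched by the shift hypothesis, and
  column 0 is matched by the choice of \<open>w\<close>, whatever \<open>M * B\<close> contains
  there.\<close>

lemma mult_eq_obs_mat_mult:
  fixes M :: "'a::comm_ring_1 mat"
  assumes M: "M \<in> carrier_mat n n" and B: "B \<in> carrier_mat n n"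
    and M0: "\<And>j. j < n \<Longrightarrow> M $$ (0, j) = (if j = 0 then 1 else 0)"
    and shift: "\<And>i j. i < n \<Longrightarrow> 0 < j \<Longrightarrow> j < n \<Longrightarrow>
      (M * B) $$ (i, j) = (if Suc i < n then M $$ (Suc i, j) else 0)"
  shows "\<exists>w. M * B = obs_mat n w * M"
proof
  \<comment> \<open>The defect of the shift relation in column 0.\<close>
  let ?w = "vec n (\<lambda>i. (M * B) $$ (i, 0) - (if Suc i < n then M $$ (Suc i, 0) else 0))"
  show "M * B = obs_mat n ?w * M"
  proof (rule eq_matI)
    fix i j assume "i < dim_row (obs_mat n ?w * M)" "j < dim_col (obs_mat n ?w * M)"
    then have ij: "i < n" "j < n" using M by (auto simp: obs_mat_def)
    have "(obs_mat n ?w * M) $$ (i, j) = (obs_mat n ?w *\<^sub>v col M j) $ i"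
      using M ij by (simp add: obs_mat_def)
    also have "\<dots> = ?w $ i * M $$ (0, j) + (if Suc i < n then M $$ (Suc i, j) else 0)"
      using M ij by (subst obs_mat_mult_vec_index) auto
    also have "\<dots> = (M * B) $$ (i, j)"
      using ij shift M0 by (cases "j = 0") auto
    finally show "(M * B) $$ (i, j) = (obs_mat n ?w * M) $$ (i, j)" ..
  qed (use M B in \<open>auto simp: obs_mat_def\<close>)
qed

section \<open>Solutions under invertible affine maps\<close>

text \<open>Derivatives are taken within \<open>I\<close>, so only values on \<open>I\<close>
  matter; outside \<open>I\<close> the curves need not even have the right dimension.\<close>

lemma has_vec_deriv_cong:
  assumes "\<And>\<tau>. \<tau> \<in> I \<Longrightarrow> x \<tau> = y \<tau>" and "t \<in> I"
  shows "has_vec_deriv n x w t I \<longleftrightarrow> has_vec_deriv n y w t I"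
  unfolding has_vec_deriv_def
  using assms by (intro all_cong has_field_derivative_cong_eventually) (auto simp: eventually_at_filter)

lemma has_vec_deriv_affine:
  assumes M: "M \<in> carrier_mat n n" and u: "u \<in> carrier_vec n" and w: "w \<in> carrier_vec n"
    and x: "\<And>\<tau>. \<tau> \<in> I \<Longrightarrow> x \<tau> \<in> carrier_vec n" and t: "t \<in> I"
    and deriv: "has_vec_deriv n x w t I"
  shows "has_vec_deriv n (\<lambda>\<tau>. M *\<^sub>v x \<tau> + u) (M *\<^sub>v w) t I"
  unfolding has_vec_deriv_def
proof (intro allI impI)
  fix i assume i: "i < n"
  have "((\<lambda>\<tau>. (\<Sum>j<n. M $$ (i, j) * x \<tau> $ j) + u $ i) has_real_derivative
      (\<Sum>j<n. M $$ (i, j) * w $ j) + 0) (at t within I)"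
    by (intro DERIV_add DERIV_sum DERIV_cmult DERIV_const) (use deriv in \<open>auto simp: has_vec_deriv_def\<close>)
  moreover have "(M *\<^sub>v w) $ i = (\<Sum>j<n. M $$ (i, j) * w $ j) + 0"
    using M w i by (auto simp: scalar_prod_def atLeast0LessThan intro!: sum.cong)
  moreover have "(M *\<^sub>v x \<tau> + u) $ i = (\<Sum>j<n. M $$ (i, j) * x \<tau> $ j) + u $ i" if "\<tau> \<in> I" for \<tau>
    using M u x[OF that] i by (auto simp: scalar_prod_def atLeast0LessThan intro!: sum.cong)
  ultimately show "((\<lambda>\<tau>. (M *\<^sub>v x \<tau> + u) $ i) has_real_derivative (M *\<^sub>v w) $ i) (at t within I)"
    \<comment> \<open>The two expressions agree on all of \<open>I\<close>, so the radius 1 is an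
      arbitrary choice.\<close>
    using t by (auto intro: has_field_derivative_transform_within[where d = 1])
qed

text \<open>The converse direction is the forward one applied to the inverse map, which sends
  \<open>y\<close> to \<open>N y - N u\<close>.\<close>

lemma has_vec_deriv_affine_iff:
  assumes M: "M \<in> carrier_mat n n" and N: "N \<in> carrier_mat n n" and NM: "N * M = 1\<^sub>m n"
    and u: "u \<in> carrier_vec n" and w: "w \<in> carrier_vec n"
    and x: "\<And>\<tau>. \<tau> \<in> I \<Longrightarrow> x \<tau> \<in> carrier_vec n" and t: "t \<in> I"
  shows "has_vec_deriv n (\<lambda>\<tau>. M *\<^sub>v x \<tau> + u) (M *\<^sub>v w) t I \<longleftrightarrow> has_vec_deriv n x w t I"
proof
  have NMv: "N *\<^sub>v (M *\<^sub>v v) = v" if "v \<in> carrier_vec n" for v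
    using assoc_mult_mat_vec[OF N M that] NM that by simp
  assume deriv: "has_vec_deriv n (\<lambda>\<tau>. M *\<^sub>v x \<tau> + u) (M *\<^sub>v w) t I"
  have "has_vec_deriv n (\<lambda>\<tau>. N *\<^sub>v (M *\<^sub>v x \<tau> + u) + - (N *\<^sub>v u)) (N *\<^sub>v (M *\<^sub>v w)) t I"
    by (rule has_vec_deriv_affine[OF N _ _ _ t deriv]) (use M N u w x in auto)
  then have deriv: "has_vec_deriv n (\<lambda>\<tau>. N *\<^sub>v (M *\<^sub>v x \<tau> + u) + - (N *\<^sub>v u)) w t I"
    unfolding NMv[OF w] .
  have "N *\<^sub>v (M *\<^sub>v x \<tau> + u) + - (N *\<^sub>v u) = x \<tau>" if "\<tau> \<in> I" for \<tau>
  proof -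
    have Nu: "N *\<^sub>v u \<in> carrier_vec n" using N u by simp
    have "N *\<^sub>v (M *\<^sub>v x \<tau> + u) = x \<tau> + N *\<^sub>v u"
      using mult_add_distrib_mat_vec[OF N _ u, of "M *\<^sub>v x \<tau>"] M x[OF that] NMv by simp
    then show ?thesis using Nu x[OF that] by (intro eq_vecI) auto
  qed
  from has_vec_deriv_cong[OF this t] deriv show "has_vec_deriv n x w t I"
    by (rule iffD1)
qed (rule has_vec_deriv_affine[OF M u w x t])

text \<open>The equations \<open>MA\<close> and \<open>Mg\<close> together say that \<open>M\<close>
  carries the source vector field at \<open>x\<close> to the target field at \<open>T x m\<close>,
  with parameter \<open>\<sigma> * m\<close>. The conditions \<open>row0\<close> and
  \<open>u0\<close> make \<open>T\<close> preserve the first coordinate, hence each of the two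
  half-spaces.\<close>

lemma transforms_pwl_affineI:
  fixes M A\<^sub>L A\<^sub>R B\<^sub>L B\<^sub>R :: "real mat" and u g h :: "real vec" and \<sigma> :: real
    and T :: "real vec \<Rightarrow> real \<Rightarrow> real vec" and S :: "real \<Rightarrow> real"
  assumes n: "0 < n" and M: "M \<in> carrier_mat n n" and inv: "invertible_mat M"
    and u: "u \<in> carrier_vec n" and g: "g \<in> carrier_vec n" and h: "h \<in> carrier_vec n"
    and A: "A\<^sub>L \<in> carrier_mat n n" "A\<^sub>R \<in> carrier_mat n n"
    and B: "B\<^sub>L \<in> carrier_mat n n" "B\<^sub>R \<in> carrier_mat n n"
    and T: "\<And>x m. x \<in> carrier_vec n \<Longrightarrow> T x m = M *\<^sub>v x + m \<cdot>\<^sub>v u"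
    and S: "\<And>m. S m = \<sigma> * m" and \<sigma>: "\<sigma> \<noteq> 0"
    and row0: "row M 0 = unit_vec n 0" and u0: "u $ 0 = 0"
    and MA: "M * A\<^sub>L = B\<^sub>L * M" "M * A\<^sub>R = B\<^sub>R * M"
    and Mg: "M *\<^sub>v g = B\<^sub>L *\<^sub>v u + \<sigma> \<cdot>\<^sub>v h" "M *\<^sub>v g = B\<^sub>R *\<^sub>v u + \<sigma> \<cdot>\<^sub>v h"
  shows "transforms_pwl n T S A\<^sub>L A\<^sub>R g B\<^sub>L B\<^sub>R h"
proof -
  obtain N where MN: "M * N = 1\<^sub>m n" and NM: "N * M = 1\<^sub>m (dim_row N)"
    using inv M by (auto simp: invertible_mat_def inverts_mat_def)
  have N: "N \<in> carrier_mat n n"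
    using arg_cong[OF MN, of dim_col] arg_cong[OF NM, of dim_col] M by auto
  then have NM: "N * M = 1\<^sub>m n" using NM by simp
  have NMv: "N *\<^sub>v (M *\<^sub>v v) = v" and MNv: "M *\<^sub>v (N *\<^sub>v v) = v" if "v \<in> carrier_vec n" for v
    using assoc_mult_mat_vec[OF N M that] assoc_mult_mat_vec[OF M N that] NM MN that by simp_all
  have Tc: "T x m \<in> carrier_vec n" if "x \<in> carrier_vec n" for x m
    using that M u by (simp add: T)
  have bij: "bij_betw (\<lambda>(x, m). (T x m, S m)) (carrier_vec n \<times> UNIV) (carrier_vec n \<times> UNIV)"
  \<comment> \<open>The inverse is found by solving \<open>\<mu> = \<sigma> m\<close> for
    \<open>m\<close> first, then \<open>z = M x + m u\<close> for \<open>x\<close>.\<close>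
  proof (rule bij_betw_byWitness[where f' = "\<lambda>(z, \<mu>). (N *\<^sub>v (z - (\<mu> / \<sigma>) \<cdot>\<^sub>v u), \<mu> / \<sigma>)"])
    have "M *\<^sub>v x + m \<cdot>\<^sub>v u - m \<cdot>\<^sub>v u = M *\<^sub>v x" if "x \<in> carrier_vec n" for x m
      using that M u by (intro eq_vecI) auto
    then show "\<forall>a\<in>carrier_vec n \<times> UNIV.
        (\<lambda>(z, \<mu>). (N *\<^sub>v (z - (\<mu> / \<sigma>) \<cdot>\<^sub>v u), \<mu> / \<sigma>)) ((\<lambda>(x, m). (T x m, S m)) a) = a"
      using \<sigma> NMv by (auto simp: T S)
    have "z - m \<cdot>\<^sub>v u + m \<cdot>\<^sub>v u = z" if "z \<in> carrier_vec n" for z m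
      using that u by (intro eq_vecI) auto
    then show "\<forall>a\<in>carrier_vec n \<times> UNIV.
        (\<lambda>(x, m). (T x m, S m)) ((\<lambda>(z, \<mu>). (N *\<^sub>v (z - (\<mu> / \<sigma>) \<cdot>\<^sub>v u), \<mu> / \<sigma>)) a) = a"
      using \<sigma> N u by (auto simp: T S MNv)
  qed (use Tc N u in auto)
  have T0: "T x m $ 0 = x $ 0" if "x \<in> carrier_vec n" for x m
    using that n M u u0 row0 by (simp add: T)
  have field: "M *\<^sub>v (A *\<^sub>v x + m \<cdot>\<^sub>v g) = B *\<^sub>v T x m + S m \<cdot>\<^sub>v h"
    if A: "A \<in> carrier_mat n n" and B: "B \<in> carrier_mat n n" and MA: "M * A = B * M"
      and Mg: "M *\<^sub>v g = B *\<^sub>v u + \<sigma> \<cdot>\<^sub>v h" and x: "x \<in> carrier_vec n" for A B x m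
  proof -
    have "M *\<^sub>v (A *\<^sub>v x + m \<cdot>\<^sub>v g) = M *\<^sub>v (A *\<^sub>v x) + m \<cdot>\<^sub>v (M *\<^sub>v g)"
      using M A x g by (subst mult_add_distrib_mat_vec[OF M]) (auto simp: mult_mat_vec[OF M])
    also have "M *\<^sub>v (A *\<^sub>v x) = B *\<^sub>v (M *\<^sub>v x)"
      using assoc_mult_mat_vec[OF M A x] assoc_mult_mat_vec[OF B M x] MA by simp
    also have "B *\<^sub>v (M *\<^sub>v x) + m \<cdot>\<^sub>v (M *\<^sub>v g) =
        (B *\<^sub>v (M *\<^sub>v x) + m \<cdot>\<^sub>v (B *\<^sub>v u)) + S m \<cdot>\<^sub>v h"
      using B h by (intro eq_vecI) (auto simp: S Mg algebra_simps)
    also have "B *\<^sub>v (M *\<^sub>v x) + m \<cdot>\<^sub>v (B *\<^sub>v u) = B *\<^sub>v T x m"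
      using M x u by (simp add: T[OF x] mult_add_distrib_mat_vec[OF B] mult_mat_vec[OF B])
    finally show ?thesis .
  qed
  have deriv: "has_vec_deriv n (\<lambda>\<tau>. T (x \<tau>) m) (B *\<^sub>v T (x t) m + S m \<cdot>\<^sub>v h) t I \<longleftrightarrow>
      has_vec_deriv n x (A *\<^sub>v x t + m \<cdot>\<^sub>v g) t I"
    if A: "A \<in> carrier_mat n n" and B: "B \<in> carrier_mat n n" and MA: "M * A = B * M"
      and Mg: "M *\<^sub>v g = B *\<^sub>v u + \<sigma> \<cdot>\<^sub>v h"
      and x: "\<And>\<tau>. \<tau> \<in> I \<Longrightarrow> x \<tau> \<in> carrier_vec n" and t: "t \<in> I" for A B x m t I
  proof -
    \<comment> \<open>\<open>field\<close> rewrites the target velocity as \<open>M\<close> times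
      the source velocity, the shape in which the affine equivalence applies.\<close>
    have "has_vec_deriv n (\<lambda>\<tau>. T (x \<tau>) m) (B *\<^sub>v T (x t) m + S m \<cdot>\<^sub>v h) t I \<longleftrightarrow>
        has_vec_deriv n (\<lambda>\<tau>. M *\<^sub>v x \<tau> + m \<cdot>\<^sub>v u) (M *\<^sub>v (A *\<^sub>v x t + m \<cdot>\<^sub>v g)) t I"
      unfolding field[OF A B MA Mg x[OF t]] by (rule has_vec_deriv_cong) (use T x t in auto)
    also have "\<dots> \<longleftrightarrow> has_vec_deriv n x (A *\<^sub>v x t + m \<cdot>\<^sub>v g) t I"
      using A x[OF t] g u by (intro has_vec_deriv_affine_iff[OF M N NM _ _ x t]) auto
    finally show ?thesis .
  qed
  have "pwl_solution n A\<^sub>L A\<^sub>R g m I x \<longleftrightarrow> pwl_solution n B\<^sub>L B\<^sub>R h (S m) I (\<lambda>t. T (x t) m)"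
    if x: "\<forall>t\<in>I. x t \<in> carrier_vec n" for m I x
    unfolding pwl_solution_def
  proof (intro ball_cong refl)
    fix t assume t: "t \<in> I"
    have xt: "x t \<in> carrier_vec n" using x t by blast
    show "(x t \<in> carrier_vec n \<and>
        (x t $ 0 \<le> 0 \<longrightarrow> has_vec_deriv n x (A\<^sub>L *\<^sub>v x t + m \<cdot>\<^sub>v g) t I) \<and>
        (x t $ 0 \<ge> 0 \<longrightarrow> has_vec_deriv n x (A\<^sub>R *\<^sub>v x t + m \<cdot>\<^sub>v g) t I)) \<longleftrightarrow>
      (T (x t) m \<in> carrier_vec n \<and>
        (T (x t) m $ 0 \<le> 0 \<longrightarrow>
          has_vec_deriv n (\<lambda>t. T (x t) m) (B\<^sub>L *\<^sub>v T (x t) m + S m \<cdot>\<^sub>v h) t I) \<and>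
        (T (x t) m $ 0 \<ge> 0 \<longrightarrow>
          has_vec_deriv n (\<lambda>t. T (x t) m) (B\<^sub>R *\<^sub>v T (x t) m + S m \<cdot>\<^sub>v h) t I))"
      using deriv[OF A(1) B(1) MA(1) Mg(1) _ t, of x m] deriv[OF A(2) B(2) MA(2) Mg(2) _ t, of x m]
        x xt Tc[OF xt, of m] T0[OF xt, of m] by simp
  qed
  then show ?thesis
    using bij T0 by (simp add: transforms_pwl_def)
qed

section \<open>The scaling E and its inverse\<close>

text \<open>A right inverse of a square matrix over a field is two-sided; this excludes the result
  \<open>None\<close>, and uniqueness of inverses identifies the value.\<close>

lemma the_mat_inverse_eqI:
  fixes A :: "'a::field mat"
  assumes A: "A \<in> carrier_mat n n" and B: "B \<in> carrier_mat n n" and AB: "A * B = 1\<^sub>m n"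
  shows "the (mat_inverse A) = B"
proof (cases "mat_inverse A")
  case None
  then have "A \<notin> Units (ring_mat TYPE('a) n ())"
    by (rule mat_inverse(1)[OF A])
  then show ?thesis
    using A B AB mat_mult_left_right_inverse[OF A B AB] by (auto simp: Units_def ring_mat_def)
next
  case (Some C)
  then have C: "C \<in> carrier_mat n n" "C * A = 1\<^sub>m n"
    using mat_inverse(2)[OF A] by auto
  have "C = C * (A * B)" using AB C by simp
  also have "\<dots> = B" using assoc_mult_mat[OF C(1) A B] C B by simp
  finally show ?thesis using Some by simp
qed

definition E_inv :: "nat \<Rightarrow> nat \<Rightarrow> real \<Rightarrow> real mat" where
  "E_inv k n \<epsilon> = mat_diag n (\<lambda>i. if i < k then 1 else 1 / \<epsilon> ^ (i - k))"

lemma E_inv_carrier [simp]: "E_inv k n \<epsilon> \<in> carrier_mat n n"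
  by (simp add: E_inv_def)

lemma the_mat_inverse_E_mat:
  assumes "\<epsilon> \<noteq> 0"
  shows "the (mat_inverse (E_mat k n \<epsilon>)) = E_inv k n \<epsilon>"
proof (rule the_mat_inverse_eqI)
  show "E_mat k n \<epsilon> * E_inv k n \<epsilon> = 1\<^sub>m n"
    using assms unfolding E_mat_def E_inv_def mat_diag_diag
    by (intro eq_matI) (auto simp: mat_diag_def)
qed (auto simp: E_mat_def)

lemma det_E_inv:
  assumes "\<epsilon> \<noteq> 0"
  shows "det (E_inv k n \<epsilon>) \<noteq> 0"
proof -
  have "det (E_inv k n \<epsilon>) = prod_list (diag_mat (E_inv k n \<epsilon>))"
    by (rule det_lower_triangular[of n]) (auto simp: E_inv_def mat_diag_def)
  then show ?thesis
    using assms unfolding prod_list_diag_prod by (auto simp: E_inv_def mat_diag_def)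
qed

text \<open>Conjugation by E multiplies superdiagonal entry \<open>(i, i + 1)\<close> by the ratio
  of the diagonal entries \<open>i + 1\<close> and \<open>i\<close> of E, which is 1 for
  \<open>i < k\<close> and \<open>\<epsilon>\<close> from then on. Column 0 is only scaled by rows,
  as the first diagonal entry of E is 1: row \<open>k + i\<close> becomes
  \<open>w $ (k + i) / \<epsilon> ^ i\<close>, and equating this with
  \<open>- \<epsilon> b_i\<close> gives the power \<open>Suc i\<close> in the vector
  \<open>b\<close>.\<close>

lemma E_inv_mult_obs_mat:
  assumes "1 \<le> k" and "\<epsilon> \<noteq> 0"
  shows "E_inv k n \<epsilon> * obs_mat n w =
    C_mat k n \<epsilon> (vec k (\<lambda>i. - (w $ i))) (vec (n - k) (\<lambda>i. - (w $ (k + i)) / \<epsilon> ^ Suc i)) * E_inv k n \<epsilon>"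
  unfolding E_inv_def
  using assms
  by (subst mat_diag_mult_left[of _ n n], simp, subst mat_diag_mult_right[of _ n n])
    (auto simp: C_mat_def obs_mat_def Suc_diff_le intro!: eq_matI)

text \<open>The last diagonal entry of E is \<open>\<epsilon> ^ (n - k - 1)\<close>. Splitting off
  the factor \<open>\<epsilon>\<close> of the canonical forcing term leaves the power
  \<open>n - k\<close> that appears in the rescaled parameter.\<close>

lemma E_inv_mult_unit_vec:
  assumes "k < n" and "\<epsilon> \<noteq> 0"
  shows "E_inv k n \<epsilon> *\<^sub>v unit_vec n (n - 1) = (1 / \<epsilon> ^ (n - k)) \<cdot>\<^sub>v (\<epsilon> \<cdot>\<^sub>v unit_vec n (n - 1))"
proof -
  have "\<epsilon> ^ (n - k) = \<epsilon> * \<epsilon> ^ (n - Suc k)"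
    using assms by (metis Suc_diff_Suc power_Suc)
  then show ?thesis
    using assms by (intro eq_vecI) (auto simp: E_inv_def mat_diag_def)
qed

section \<open>The translation d and the factor s\<close>

lemma transpose_jordan_block_mult_vec_index:
  fixes y :: "'a::comm_ring_1 vec"
  assumes y: "y \<in> carrier_vec n" and i: "i < n"
  shows "(transpose_mat (jordan_block n 0) *\<^sub>v y) $ i = (if i = 0 then 0 else y $ (i - 1))"
proof -
  have "(transpose_mat (jordan_block n 0) *\<^sub>v y) $ i = col (jordan_block n 0) i \<bullet> y"
    using i by simp
  also have "\<dots> = (\<Sum>l<n. col (jordan_block n 0) i $ l * y $ l)"
    using y by (simp only: scalar_prod_def atLeast0LessThan carrier_vecD)
  also have "\<dots> = (\<Sum>l<n. if Suc l = i then y $ l else 0)"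
    using i by (intro sum.cong refl) (simp_all add: col_def)
  also have "\<dots> = (if i = 0 then 0 else y $ (i - 1))"
  proof (cases i)
    case (Suc j)
    then show ?thesis using i by simp
  qed simp
  finally show ?thesis .
qed

lemma d_vec_index:
  assumes "i < n"
  shows "d_vec n P c $ i = (if i = 0 then 0 else (Q_mat n P *\<^sub>v c) $ (i - 1))"
  unfolding d_vec_def
  by (rule transpose_jordan_block_mult_vec_index[OF _ assms])
    (rule carrier_vecI, simp only: dim_mult_mat_vec carrier_matD(1)[OF Q_mat_carrier])

lemma d_vec_carrier [simp]: "d_vec n P c \<in> carrier_vec n"
  unfolding d_vec_def by (rule carrier_vecI) (simp only: dim_mult_mat_vec index_transpose_mat jordan_block_def dim_col_mat)

text \<open>The first entry of \<open>d\<close> is 0, so \<open>w\<close> has no effect and the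
  product with \<open>d\<close> is just \<open>Q c\<close> with its last entry replaced by 0; the
  multiple of \<open>e_n\<close> restores that entry. As \<open>w\<close> is arbitrary, one
  translation serves both half-systems.\<close>

lemma Q_mat_mult_vec:
  assumes n: "0 < n"
  shows "Q_mat n P *\<^sub>v c = obs_mat n w *\<^sub>v d_vec n P c + s_val n P c \<cdot>\<^sub>v unit_vec n (n - 1)"
proof (rule eq_vecI)
  let ?y = "Q_mat n P *\<^sub>v c"
  have y: "?y \<in> carrier_vec n"
    by (rule carrier_vecI) (simp only: dim_mult_mat_vec carrier_matD(1)[OF Q_mat_carrier])
  fix i assume "i < dim_vec (obs_mat n w *\<^sub>v d_vec n P c + s_val n P c \<cdot>\<^sub>v unit_vec n (n - 1))"
  then have i: "i < n" by simp
  have s: "s_val n P c = ?y $ (n - 1)"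
    unfolding s_val_def by (rule scalar_prod_left_unit[OF y]) (use n in simp)
  have "(obs_mat n w *\<^sub>v d_vec n P c + s_val n P c \<cdot>\<^sub>v unit_vec n (n - 1)) $ i =
      (obs_mat n w *\<^sub>v d_vec n P c) $ i + (if Suc i < n then 0 else ?y $ i)"
    using i n by (cases "i = n - 1") (auto simp: s simp del: index_mult_mat_vec)
  also have "\<dots> = ?y $ i"
    unfolding obs_mat_mult_vec_index[OF d_vec_carrier i] d_vec_index[OF n]
    by (cases "Suc i < n") (simp_all add: d_vec_index del: index_mult_mat_vec)
  finally show "?y $ i = (obs_mat n w *\<^sub>v d_vec n P c + s_val n P c \<cdot>\<^sub>v unit_vec n (n - 1)) $ i" ..
qed (use carrier_matD[OF Q_mat_carrier, of n P] in simp)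

section \<open>Reduction of the slow-fast system to observer form\<close>

theorem proposition2p2:
  fixes k n :: nat and \<epsilon> :: real
    and U\<^sub>L U\<^sub>R V\<^sub>L V\<^sub>R P\<^sub>L P\<^sub>R :: "real \<Rightarrow> real mat" and q r c :: "real \<Rightarrow> real vec"
  assumes "1 \<le> k" and "k < n" and "\<epsilon> > 0"
    and "U\<^sub>L \<epsilon> \<in> carrier_mat k n" and "V\<^sub>L \<epsilon> \<in> carrier_mat (n - k) n"
    and "U\<^sub>R \<epsilon> \<in> carrier_mat k n" and "V\<^sub>R \<epsilon> \<in> carrier_mat (n - k) n"
    and "q \<epsilon> \<in> carrier_vec k" and "r \<epsilon> \<in> carrier_vec (n - k)"
    and "P\<^sub>L \<epsilon> = U\<^sub>L \<epsilon> @\<^sub>r (\<epsilon> \<cdot>\<^sub>m V\<^sub>L \<epsilon>)"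
    and "P\<^sub>R \<epsilon> = U\<^sub>R \<epsilon> @\<^sub>r (\<epsilon> \<cdot>\<^sub>m V\<^sub>R \<epsilon>)"
    and "c \<epsilon> = q \<epsilon> @\<^sub>v (\<epsilon> \<cdot>\<^sub>v r \<epsilon>)"
    and continuous: "\<forall>j. 1 \<le> j \<and> j < n \<longrightarrow> col (P\<^sub>L \<epsilon>) j = col (P\<^sub>R \<epsilon>) j"
    and "invertible_mat (Phi_mat n (P\<^sub>L \<epsilon>))"
    and "s_val n (P\<^sub>L \<epsilon>) (c \<epsilon>) \<noteq> 0"
  shows "\<exists>a\<^sub>L\<in>carrier_vec k. \<exists>b\<^sub>L\<in>carrier_vec (n - k).
         \<exists>a\<^sub>R\<in>carrier_vec k. \<exists>b\<^sub>R\<in>carrier_vec (n - k).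
           transforms_pwl n
             (\<lambda>x m. the (mat_inverse (E_mat k n \<epsilon>)) *\<^sub>v
                      (Q_mat n (P\<^sub>L \<epsilon>) *\<^sub>v x + m \<cdot>\<^sub>v d_vec n (P\<^sub>L \<epsilon>) (c \<epsilon>)))
             (\<lambda>m. s_val n (P\<^sub>L \<epsilon>) (c \<epsilon>) / \<epsilon> ^ (n - k) * m)
             (P\<^sub>L \<epsilon>) (P\<^sub>R \<epsilon>) (c \<epsilon>)
             (C_mat k n \<epsilon> a\<^sub>L b\<^sub>L) (C_mat k n \<epsilon> a\<^sub>R b\<^sub>R) (\<epsilon> \<cdot>\<^sub>v unit_vec n (n - 1))"
proof -
  note k = \<open>1 \<le> k\<close> \<open>k < n\<close>
  have n: "0 < n" and kn: "k + (n - k) = n" and \<epsilon>: "\<epsilon> \<noteq> 0"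
    using k \<open>\<epsilon> > 0\<close> by auto
  let ?PL = "P\<^sub>L \<epsilon>" and ?PR = "P\<^sub>R \<epsilon>" and ?c = "c \<epsilon>"
  let ?Q = "Q_mat n ?PL" and ?d = "d_vec n ?PL ?c" and ?s = "s_val n ?PL ?c"
  let ?D = "E_inv k n \<epsilon>" and ?M = "E_inv k n \<epsilon> * Q_mat n (P\<^sub>L \<epsilon>)" and ?en = "unit_vec n (n - 1) :: real vec"
  \<comment> \<open>The vectors \<open>a\<close> and \<open>b\<close> are those produced by
    conjugating \<open>J_n + w e_1^T\<close> with E; keeping \<open>w\<close> as an argument treats
    both sides together.\<close>
  let ?C = "\<lambda>w. C_mat k n \<epsilon> (vec k (\<lambda>i. - (w $ i))) (vec (n - k) (\<lambda>i. - (w $ (k + i)) / \<epsilon> ^ Suc i))"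
  have PL: "?PL \<in> carrier_mat n n" and PR: "?PR \<in> carrier_mat n n"
    using assms carrier_append_rows[of "U\<^sub>L \<epsilon>" k n "\<epsilon> \<cdot>\<^sub>m V\<^sub>L \<epsilon>" "n - k"]
      carrier_append_rows[of "U\<^sub>R \<epsilon>" k n "\<epsilon> \<cdot>\<^sub>m V\<^sub>R \<epsilon>" "n - k"] kn by auto
  have c: "?c \<in> carrier_vec n"
    using assms append_carrier_vec[of "q \<epsilon>" k "\<epsilon> \<cdot>\<^sub>v r \<epsilon>" "n - k"] kn by auto
  have Q: "?Q \<in> carrier_mat n n" and D: "?D \<in> carrier_mat n n" and d: "?d \<in> carrier_vec n"
    by simp_all
  have M: "?M \<in> carrier_mat n n" by (rule mult_carrier_mat[OF D Q])
  have C: "?C w \<in> carrier_mat n n" for w by (simp add: C_mat_def)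

  \<comment> \<open>Q is built from \<open>P\<^sub>L\<close> alone, but by continuity
    \<open>P\<^sub>R\<close> has the same columns \<open>j > 0\<close>, so the shift relation passes
    to \<open>P\<^sub>R\<close>; the two sides differ only in \<open>w\<close>.\<close>
  have "(?Q * ?PR) $$ (i, j) = (?Q * ?PL) $$ (i, j)" if "i < n" "0 < j" "j < n" for i j
    using that continuous carrier_matD[OF PL] carrier_matD[OF PR] carrier_matD[OF Q] by simp
  then have shift: "(?Q * P) $$ (i, j) = (if Suc i < n then ?Q $$ (Suc i, j) else 0)"
    if "P \<in> {?PL, ?PR}" "i < n" "0 < j" "j < n" for P i j
    using that Q_mat_mult_index[OF PL] by auto
  obtain w\<^sub>L where wL: "?Q * ?PL = obs_mat n w\<^sub>L * ?Q"
    using mult_eq_obs_mat_mult[OF Q PL Q_mat_index_0[OF PL] shift] by blast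
  obtain w\<^sub>R where wR: "?Q * ?PR = obs_mat n w\<^sub>R * ?Q"
    using mult_eq_obs_mat_mult[OF Q PR Q_mat_index_0[OF PL] shift] by blast
  have conj: "?M * P = ?C w * ?M" if P: "P \<in> carrier_mat n n" and w: "?Q * P = obs_mat n w * ?Q" for P w
  proof -
    have "?M * P = ?D * (obs_mat n w * ?Q)" using w assoc_mult_mat[OF D Q P] by simp
    also have "\<dots> = (?D * obs_mat n w) * ?Q" by (rule assoc_mult_mat[OF D _ Q, symmetric]) simp
    also have "\<dots> = ?C w * ?M"
      unfolding E_inv_mult_obs_mat[OF k(1) \<epsilon>] by (rule assoc_mult_mat[OF C D Q])
    finally show ?thesis .
  qed
  have inhom: "?M *\<^sub>v ?c = ?C w *\<^sub>v (?D *\<^sub>v ?d) + (?s / \<epsilon> ^ (n - k)) \<cdot>\<^sub>v (\<epsilon> \<cdot>\<^sub>v ?en)" for w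
  proof -
    have od: "obs_mat n w *\<^sub>v ?d \<in> carrier_vec n" by (rule mult_mat_vec_carrier[OF obs_mat_carrier d])
    have "?M *\<^sub>v ?c = ?D *\<^sub>v (obs_mat n w *\<^sub>v ?d + ?s \<cdot>\<^sub>v ?en)"
      unfolding assoc_mult_mat_vec[OF D Q c] by (subst Q_mat_mult_vec[OF n]) simp
    also have "\<dots> = ?D *\<^sub>v (obs_mat n w *\<^sub>v ?d) + ?s \<cdot>\<^sub>v (?D *\<^sub>v ?en)"
      using od by (simp add: mult_add_distrib_mat_vec[OF D] mult_mat_vec[OF D])
    also have "?D *\<^sub>v (obs_mat n w *\<^sub>v ?d) = ?C w *\<^sub>v (?D *\<^sub>v ?d)"
      using assoc_mult_mat_vec[OF D obs_mat_carrier d, of w] assoc_mult_mat_vec[OF C D d, of w]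
        E_inv_mult_obs_mat[OF k(1) \<epsilon>, of n w] by simp
    also have "?s \<cdot>\<^sub>v (?D *\<^sub>v ?en) = (?s / \<epsilon> ^ (n - k)) \<cdot>\<^sub>v (\<epsilon> \<cdot>\<^sub>v ?en)"
      unfolding E_inv_mult_unit_vec[OF k(2) \<epsilon>] by (simp add: smult_smult_assoc)
    finally show ?thesis .
  qed
  have D0: "row ?D 0 = unit_vec n 0"
    using k by (intro eq_vecI) (auto simp: E_inv_def mat_diag_def)
  \<comment> \<open>Both factors have first row \<open>e_1^T\<close>. With the vanishing first entry
    of the translation this means that the first coordinate is unchanged.\<close>
  have M0: "row ?M 0 = unit_vec n 0"
  proof (rule eq_vecI)
    fix j assume "j < dim_vec (unit_vec n 0 :: real vec)"
    then have j: "j < n" by simp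
    then have "?M $$ (0, j) = ?Q $$ (0, j)"
      using n carrier_matD[OF D] carrier_matD[OF Q] D0 by (simp add: carrier_dim_vec)
    then show "row ?M 0 $ j = unit_vec n 0 $ j"
      using j n carrier_matD[OF M] Q_mat_index_0[OF PL j] by (simp del: index_mult_mat)
  qed (use carrier_matD(2)[OF Q] in simp)
  have "det ?M \<noteq> 0"
    using det_mult[OF D Q] det_E_inv[OF \<epsilon>, of k n] assms(14) invertible_Q_mat
      invertible_mat_iff_det[OF Q] by simp
  then have inv: "invertible_mat ?M" using invertible_mat_iff_det[OF M] by simp
  have "transforms_pwl n
      (\<lambda>x m. the (mat_inverse (E_mat k n \<epsilon>)) *\<^sub>v (?Q *\<^sub>v x + m \<cdot>\<^sub>v ?d))
      (\<lambda>m. ?s / \<epsilon> ^ (n - k) * m) ?PL ?PR ?c (?C w\<^sub>L) (?C w\<^sub>R) (\<epsilon> \<cdot>\<^sub>v ?en)"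
  proof (rule transforms_pwl_affineI[where \<sigma> = "?s / \<epsilon> ^ (n - k)",
      OF n M inv mult_mat_vec_carrier[OF D d] c _ PL PR C C])
    show "the (mat_inverse (E_mat k n \<epsilon>)) *\<^sub>v (?Q *\<^sub>v x + m \<cdot>\<^sub>v ?d) = ?M *\<^sub>v x + m \<cdot>\<^sub>v (?D *\<^sub>v ?d)"
      if x: "x \<in> carrier_vec n" for x m
    proof -
      have "?Q *\<^sub>v x \<in> carrier_vec n" using mult_mat_vec_carrier[OF Q x] .
      then show ?thesis
        unfolding the_mat_inverse_E_mat[OF \<epsilon>] assoc_mult_mat_vec[OF D Q x]
        by (simp add: mult_add_distrib_mat_vec[OF D] mult_mat_vec[OF D])
    qed
    show "(?D *\<^sub>v ?d) $ 0 = 0" using n d carrier_matD[OF D] D0 d_vec_index[OF n] by simp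
    show "?s / \<epsilon> ^ (n - k) \<noteq> 0" using assms(15) \<epsilon> by simp
  qed (rule M0 conj[OF PL wL] conj[OF PR wR] inhom smult_carrier_vec[THEN iffD2] unit_vec_carrier refl)+
  then show ?thesis by (intro bexI[OF _ vec_carrier])
qed

end
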